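(* Consider a degenerate linear program with 4 variables and 2 constraints, $$\text{maximize } z=\sum_{j=1}^4c_jx_j\quad\text{subject to}\quad \sum_{j=1}^4N_{ij}x_j\le 0\ (i=1,2),\qquad x_j\ge 0,$$ with all variables initially zero and initial tableau $M^{(1)}$ (a $3\times 6$ matrix) whose upper-left $2\times2$ block is $A=(A_{ij})$, normalized so that the objective row has first entry $-1$ and second entry $\mu$, and so that $A_{21}<0<A_{12}$. Let $\tau>0$ and $u\ge0$ be the EXPAND parameters. When the most negative reduced cost column selection rule and the EXPAND row selection rule are used, the problem has the 2/6-cycle pattern and cycles indefinitely if and only if all of the following hold: (i) $$M^{(1)}=\begin{bmatrix} A_{11} & A_{12} & -(A_{11}+1) & -A_{12} & 1 & 0\\ A_{21} & -(A_{11}+1) & -A_{21} & A_{11} & 0 & 1\\ -1 & \mu & -(A_{11}+1)+\mu A_{21} & -A_{12}-\mu A_{11} & 0 & 0\end{bmatrix}\quad\text{and}\quad -A_{21}A_{12}=1+A_{11}+A_{11}^2;$$ (ii) $0<A_{11}\le\frac12$ and $0<A_{12}$; (iii) $$-1<\mu<-\frac{A_{12}(A_{11}+2)}{A_{11}(A_{11}+1)}$$ (which implies $A_{12}<A_{11}\left(\frac{A_{11}+1}{A_{11}+2}\right)$).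
   Context: Slack variables $x_5,x_6$ are added to constraints 1 and 2 and form the initial basis; the objective is written as the row $z-\sum_jc_jx_j=0$. $M^{(n)}$ denotes the $3\times6$ matrix of coefficients of $x_1,\dots,x_6$ in the two constraint rows (rows 1, 2) and the objective row (row 3) at the start of iteration $n$; thus $M^{(1)}=\begin{bmatrix}N&I\\-c^T&0\end{bmatrix}$. The right-hand sides of the constraints are $0$. Each iteration is a simplex (Gauss-Jordan) pivot. Column selection (most negative reduced cost): the entering column is the one with the most negative entry in row 3; if no entry is negative the method stops. If this rule does not determine the column uniquely, a choice is assumed to be made which breaks the 2/6-cycle pattern. EXPAND row selection: in iteration $n$ the feasibility tolerance is $\delta=\tau u^n$ where $u^n=u+n$ (the superscript is an index; the initial tolerance is $\tau u$). Let $p$ be the entering column of the current tableau, with entry $p_j$ in the row of the basic variable $x_j$. A step $\alpha$ increases the entering variable by $\alpha$ and changes each basic variable from $x_j$ to $x_j-\alpha p_j$; the other nonbasic variables are unchanged. - First pass: $\alpha^{\max}$ is the largest $\alpha$ such that $x_j-\alpha p_j\ge-\delta$ for all basic $j$, i.e. $\alpha^{\max}=\min_{p_j>0}(x_j+\delta)/p_j$. - Second pass: put $\alpha_j=x_j/p_j$ if $p_j>0$ and $\alpha_j=\infty$ otherwise. The leaving variable $x_r$ is the one with the largest $p_j$ among the basic $j$ with $\alpha_j\le\alpha^{\max}$ (if there is a tie, row 1 is chosen). - Step: $\alpha^{\rm full}=\alpha_r$, $\alpha^{\min}=\tau/p_r$, and the step taken is $\alpha=\max(\alpha^{\min},\alpha^{\rm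 full})$. The leaving variable becomes nonbasic at its resulting value $x_r-\alpha p_r$, which need not be zero. If no $p_j$ is positive, the method stops (unbounded). No resetting of the tolerance or of the variable values is performed. 2/6-cycle pattern: in iteration $n=1,2,3,\dots$ the pivot is in column $n$ (column indices taken modulo 6 in $\{1,\dots,6\}$), in row 1 if $n$ is odd and in row 2 if $n$ is even, and the coefficients repeat after two iterations, meaning that $M^{(3)}$ equals $M^{(1)}$ with its columns shifted cyclically two places to the right. Cycling indefinitely means that this pattern continues forever (so the sequence of bases and tableaux repeats with period 6). Normalizations: since column 1 enters first it has a negative objective row entry, and positive scaling of the objective row is immaterial, so that entry is scaled to $-1$. In a 2/6-cycle example $A_{12}$ and $A_{21}$ have opposite signs, and the case $A_{21}>0$ corresponds to the case $A_{21}<0$ after shifting the columns cyclically by one place and interchanging the two rows, so $A_{21}<0<A_{12}$ is taken as a convention. *)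

theory Defs
  imports "HOL-Analysis.Analysis" "HOL-Library.Numeral_Type"
begin

(* The linear program is: maximize c \<bullet> x subject to N *v x \<le> 0 and x \<ge> 0, with N :: real^4^2.
   Slack variables x_5, x_6 turn the constraints into equations, the objective being the row
   z - c \<bullet> x = 0.  Columns are indexed by the cyclic type 6, whose arithmetic is modulo 6, so that
   column 6 is the index 0.  Rows 1 and 2 are the constraint rows, row 3 is the objective row. *)

definition initial_tableau :: "real^4^2 \<Rightarrow> real^4 \<Rightarrow> real^6^3" where
  "initial_tableau N c = vector
     [vector [N$1$1, N$1$2, N$1$3, N$1$4, 1, 0],
      vector [N$2$1, N$2$2, N$2$3, N$2$4, 0, 1],
      vector [- (c$1), - (c$2), - (c$3), - (c$4), 0, 0]]"

definition constraint_rows :: "3 set" where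
  "constraint_rows = {1, 2}"

(* basis S i is the index of the variable that is basic in constraint row i; its value at the
   objective row 3 carries no information.  Nonbasic variables may have nonzero values. *)
record simplex_state =
  tableau :: "real^6^3"
  basis :: "3 \<Rightarrow> 6"
  vals :: "real^6"

definition initial_state :: "real^4^2 \<Rightarrow> real^4 \<Rightarrow> simplex_state" where
  "initial_state N c =
     \<lparr> tableau = initial_tableau N c, basis = (\<lambda>i. if i = 1 then 5 else 6), vals = 0 \<rparr>"

(* All columns that the most negative reduced cost rule may select; empty if the method stops. *)
definition entering_columns :: "real^6^3 \<Rightarrow> 6 set" where
  "entering_columns M = {k. M$3$k < 0 \<and> (\<forall>j. M$3$k \<le> M$3$j)}"

definition gauss_jordan_pivot :: "real^6^3 \<Rightarrow> 3 \<Rightarrow> 6 \<Rightarrow> real^6^3" where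
  "gauss_jordan_pivot M r k =
     (\<chi> i j. if i = r then M$r$j / M$r$k else M$i$j - M$i$k * (M$r$j / M$r$k))"

definition alpha_max :: "real \<Rightarrow> simplex_state \<Rightarrow> 6 \<Rightarrow> real" where
  "alpha_max \<delta> S k =
     Min ((\<lambda>i. (vals S $ basis S i + \<delta>) / tableau S $ i $ k) `
          {i \<in> constraint_rows. tableau S $ i $ k > 0})"

(* Rows with a ratio x_j / p_j of at most alpha_max; rows without a positive entry in the entering
   column have ratio infinity and never qualify.  The set is empty if the method stops because
   the entering column has no positive entry. *)
definition eligible_rows :: "real \<Rightarrow> simplex_state \<Rightarrow> 6 \<Rightarrow> 3 set" where
  "eligible_rows \<delta> S k =
     {i \<in> constraint_rows. tableau S $ i $ k > 0 \<and>
        vals S $ basis S i / tableau S $ i $ k \<le> alpha_max \<delta> S k}"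

definition leaving_row :: "real \<Rightarrow> simplex_state \<Rightarrow> 6 \<Rightarrow> 3 \<Rightarrow> bool" where
  "leaving_row \<delta> S k r \<longleftrightarrow>
     r \<in> eligible_rows \<delta> S k \<and>
     (\<forall>i \<in> eligible_rows \<delta> S k. tableau S $ i $ k \<le> tableau S $ r $ k) \<and>
     (r = 1 \<or> (\<forall>i \<in> eligible_rows \<delta> S k. i \<noteq> r \<longrightarrow> tableau S $ i $ k < tableau S $ r $ k))"

definition step_length :: "real \<Rightarrow> simplex_state \<Rightarrow> 6 \<Rightarrow> 3 \<Rightarrow> real" where
  "step_length \<tau> S k r =
     max (\<tau> / tableau S $ r $ k) (vals S $ basis S r / tableau S $ r $ k)"

definition move :: "simplex_state \<Rightarrow> 6 \<Rightarrow> real \<Rightarrow> real^6" where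
  "move S k \<alpha> =
     (\<chi> j. vals S $ j + (if j = k then \<alpha> else 0)
            - (\<Sum>i | i \<in> constraint_rows \<and> basis S i = j. \<alpha> * tableau S $ i $ k))"

definition next_state :: "real \<Rightarrow> simplex_state \<Rightarrow> 6 \<Rightarrow> 3 \<Rightarrow> simplex_state" where
  "next_state \<tau> S k r =
     \<lparr> tableau = gauss_jordan_pivot (tableau S) r k,
       basis = (basis S)(r := k),
       vals = move S k (step_length \<tau> S k r) \<rparr>"

(* Iteration n pivots in row r and column k; its feasibility tolerance is tau * (u + n). *)
definition expand_iteration ::
    "real \<Rightarrow> real \<Rightarrow> nat \<Rightarrow> simplex_state \<Rightarrow> 6 \<Rightarrow> 3 \<Rightarrow> simplex_state \<Rightarrow> bool" where
  "expand_iteration \<tau> u n S k r S' \<longleftrightarrow>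
     k \<in> entering_columns (tableau S) \<and>
     leaving_row (\<tau> * (u + real n)) S k r \<and>
     S' = next_state \<tau> S k r"

(* S n is the state at the start of iteration n, for n \<ge> 1.  If several columns tie for the most
   negative reduced cost, a choice breaking the pattern is made; hence the pattern demands that
   its column is the only candidate.  Shifting the columns two places to the right moves the
   entry in column j - 2 to column j (modulo 6). *)
definition cycles_2_6 :: "real \<Rightarrow> real \<Rightarrow> real^4^2 \<Rightarrow> real^4 \<Rightarrow> bool" where
  "cycles_2_6 \<tau> u N c \<longleftrightarrow>
     (\<exists>S :: nat \<Rightarrow> simplex_state.
        S 1 = initial_state N c \<and>
        (\<forall>n\<ge>1. entering_columns (tableau (S n)) = {of_nat n} \<and>
               expand_iteration \<tau> u n (S n) (of_nat n) (if odd n then 1 else 2) (S (Suc n))) \<and>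
        tableau (S 3) = (\<chi> i j. tableau (S 1) $ i $ (j - 2)))"

end

theory Submission
  imports Defs
begin

text \<open>
  Two pivots turn the blocks \<open>[A | B | I]\<close> of the constraint rows into \<open>[I | A\<inverse>B | A\<inverse>]\<close>, so the
  coefficients repeat iff \<open>B = A\<inverse> = A\<^sup>2\<close>; as \<open>det A > 0\<close> and \<open>A\<close> is not diagonal, this means
  \<open>det A = 1\<close> and \<open>trace A = -1\<close>.  The bounds on \<open>\<mu>\<close> come from the column rule in the first two
  iterations.

  The iterations commute with a cyclic shift of the columns, so the dynamics of the variable values
  reduces to the recursion, for one pair of pivots, of the two basic values.  In units of \<open>\<tau>\<close>, every odd
  iteration takes the minimal step and every even one the full step.  Row 2 is eligible in an
  even iteration iff the full step leaves the basic variable of row 1 above \<open>-\<delta>\<close>.  With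
  \<open>a = A\<^sub>1\<^sub>1 < 1\<close>, in each period of six iterations this value decreases by at most
  \<open>(1 + a + a\<^sup>2) / (1 - a) + 2 + a\<close>, and asymptotically by that much, while \<open>\<delta>\<close> grows by 6; the
  former is at most 6 iff \<open>a \<le> 1/2\<close>.  For \<open>a \<ge> 1\<close> the decreases are unbounded.
\<close>

section \<open>Arithmetic of the six cyclic columns\<close>

lemma exhaust_6:
  fixes x :: 6
  shows "x = 1 \<or> x = 2 \<or> x = 3 \<or> x = 4 \<or> x = 5 \<or> x = 0"
proof (induct x)
  case (of_int z)
  then have "z = 0 \<or> z = 1 \<or> z = 2 \<or> z = 3 \<or> z = 4 \<or> z = 5" by simp arith
  then show ?case by auto
qed

lemma forall_6: "(\<forall>i::6. P i) \<longleftrightarrow> P 1 \<and> P 2 \<and> P 3 \<and> P 4 \<and> P 5 \<and> P 0"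
  by (metis exhaust_6)

lemma numeral_6 [simp]: "(6::6) = 0" "(7::6) = 1"
  by simp_all

lemma vector_6 [simp]:
  "(vector [p,q,r,s,t,v] :: ('a::zero)^6) $ 1 = p"
  "(vector [p,q,r,s,t,v] :: ('a::zero)^6) $ 2 = q"
  "(vector [p,q,r,s,t,v] :: ('a::zero)^6) $ 3 = r"
  "(vector [p,q,r,s,t,v] :: ('a::zero)^6) $ 4 = s"
  "(vector [p,q,r,s,t,v] :: ('a::zero)^6) $ 5 = t"
  "(vector [p,q,r,s,t,v] :: ('a::zero)^6) $ 0 = v"
  unfolding vector_def by simp_all

lemma minus_6 [simp]:
   "(1::6) - 2 = 5" "(0::6) - 2 = 4" "(4::6) - 2 = 2" "(-1::6) = 5" "(-2::6) = 4"
  by simp_all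

section \<open>Invariance of iterations under cyclic column shifts\<close>

text \<open>Relabelling columns lets iterations \<open>2 * m + 1\<close> and
  \<open>2 * m + 2\<close> be read as the first two, so a single pair of pivots has to be
  analysed.\<close>

definition shift_state :: "6 \<Rightarrow> simplex_state \<Rightarrow> simplex_state" where
  "shift_state s S =
     \<lparr> tableau = (\<chi> i j. tableau S $ i $ (j - s)), basis = (\<lambda>i. basis S i + s),
       vals = (\<chi> j. vals S $ (j - s)) \<rparr>"

lemma shift_state_simps [simp]:
  "tableau (shift_state s S) $ i $ j = tableau S $ i $ (j - s)"
  "basis (shift_state s S) i = basis S i + s"
  "vals (shift_state s S) $ j = vals S $ (j - s)"
  by (simp_all add: shift_state_def)

lemma shift_state_add: "shift_state s (shift_state t S) = shift_state (s + t) S"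
  by (simp add: shift_state_def vec_eq_iff fun_eq_iff algebra_simps)

lemma shift_state_0 [simp]: "shift_state 0 S = S"
  by (simp add: shift_state_def)

lemma eligible_rows_shift [simp]:
  "eligible_rows \<delta> (shift_state s S) (k + s) = eligible_rows \<delta> S k"
  by (simp add: eligible_rows_def alpha_max_def)

lemma leaving_row_shift [simp]:
  "leaving_row \<delta> (shift_state s S) (k + s) r = leaving_row \<delta> S k r"
  by (simp add: leaving_row_def)

lemma entering_columns_shift [simp]:
  "entering_columns (tableau (shift_state s S)) = (\<lambda>k. k + s) ` entering_columns (tableau S)"
proof -
  have *: "(\<forall>j. tableau S $ 3 $ (k - s) \<le> tableau S $ 3 $ (j - s)) \<longleftrightarrow>
      (\<forall>j. tableau S $ 3 $ (k - s) \<le> tableau S $ 3 $ j)" for k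
    by (metis add_diff_cancel)
  show ?thesis
    unfolding entering_columns_def shift_state_simps *
    by (auto simp: image_iff) (metis diff_add_cancel)
qed

lemma next_state_shift:
  "next_state \<tau> (shift_state s S) (k + s) r = shift_state s (next_state \<tau> S k r)"
  by (auto simp: next_state_def shift_state_def gauss_jordan_pivot_def move_def step_length_def
      vec_eq_iff fun_eq_iff algebra_simps)

section \<open>The EXPAND ratio test for two rows\<close>

text \<open>A ratio is at most a minimum iff it is at most every candidate; the minimum is over a
  nonempty set because \<open>r\<close> itself is a candidate.\<close>

lemma mem_eligible_rows_iff:
  "r \<in> eligible_rows \<delta> S k \<longleftrightarrow> r \<in> {1, 2} \<and> tableau S $ r $ k > 0 \<and>
     (\<forall>i\<in>{1, 2}. tableau S $ i $ k > 0 \<longrightarrow>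
        vals S $ basis S r / tableau S $ r $ k \<le> (vals S $ basis S i + \<delta>) / tableau S $ i $ k)"
proof (cases "r \<in> {1, 2} \<and> tableau S $ r $ k > 0")
  case True
  then have "{i \<in> constraint_rows. tableau S $ i $ k > 0} \<noteq> {}"
    by (auto simp: constraint_rows_def)
  with True show ?thesis
    by (auto simp: eligible_rows_def alpha_max_def constraint_rows_def)
qed (auto simp: eligible_rows_def constraint_rows_def)

text \<open>Row 1 is the only candidate, and it passes its own test because \<open>\<delta>\<close>
  can only raise the bound.\<close>

lemma leaving_row_1I:
  assumes "\<delta> \<ge> 0" "tableau S $ 1 $ k > 0" "tableau S $ 2 $ k \<le> 0"
  shows "leaving_row \<delta> S k 1"
  using assms by (auto simp: leaving_row_def mem_eligible_rows_iff divide_right_mono)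

text \<open>Row 2 passes its own test and has the larger pivot element, so only the bound coming
  from row 1 decides.\<close>

lemma leaving_row_2_iff:
  assumes "\<delta> \<ge> 0" "0 < tableau S $ 1 $ k" "tableau S $ 1 $ k < tableau S $ 2 $ k"
  shows "leaving_row \<delta> S k 2 \<longleftrightarrow>
    vals S $ basis S 2 / tableau S $ 2 $ k \<le> (vals S $ basis S 1 + \<delta>) / tableau S $ 1 $ k"
  using assms by (auto simp: leaving_row_def mem_eligible_rows_iff divide_right_mono)

lemma move_nth:
  "move S k \<alpha> $ j = vals S $ j + (if j = k then \<alpha> else 0)
     - (if basis S 1 = j then \<alpha> * tableau S $ 1 $ k else 0)
     - (if basis S 2 = j then \<alpha> * tableau S $ 2 $ k else 0)"
proof -
  have "{i. i \<in> constraint_rows \<and> basis S i = j} =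
      (if basis S 1 = j then {1} else {}) \<union> (if basis S 2 = j then {2} else {})"
    by (auto simp: constraint_rows_def)
  then show ?thesis
    by (simp add: move_def)
qed

section \<open>The run forced by the pattern\<close>

text \<open>Index \<open>m\<close> is the start of iteration \<open>m + 1\<close>; hence even
  indices pivot in row 1.\<close>

primrec pattern_run :: "real \<Rightarrow> simplex_state \<Rightarrow> nat \<Rightarrow> simplex_state" where
  "pattern_run \<tau> S 0 = S"
| "pattern_run \<tau> S (Suc m) =
     next_state \<tau> (pattern_run \<tau> S m) (of_nat (Suc m)) (if even m then 1 else 2)"

text \<open>The pattern prescribes row and column of every pivot, so the states are determined from
  iteration 1 on and the existential quantifier disappears.\<close>

lemma cycles_2_6_iff_pattern_run:
  fixes \<tau> N c
  defines "R \<equiv> pattern_run \<tau> (initial_state N c)"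
  shows "cycles_2_6 \<tau> u N c \<longleftrightarrow>
    (\<forall>m. entering_columns (tableau (R m)) = {of_nat (Suc m)} \<and>
         leaving_row (\<tau> * (u + real (Suc m))) (R m) (of_nat (Suc m)) (if even m then 1 else 2)) \<and>
    tableau (R 2) = (\<chi> i j. initial_tableau N c $ i $ (j - 2))"
    (is "_ \<longleftrightarrow> ?pattern \<and> ?shift")
proof
  assume "cycles_2_6 \<tau> u N c"
  then obtain S where S1: "S 1 = initial_state N c"
    and it: "\<And>n. n \<ge> 1 \<Longrightarrow> entering_columns (tableau (S n)) = {of_nat n} \<and>
       expand_iteration \<tau> u n (S n) (of_nat n) (if odd n then 1 else 2) (S (Suc n))"
    and S3: "tableau (S 3) = (\<chi> i j. tableau (S 1) $ i $ (j - 2))"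
    unfolding cycles_2_6_def by blast
  have S: "S (Suc m) = R m" for m
  proof (induction m)
    case 0
    then show ?case using S1 by (simp add: R_def)
  next
    case (Suc m)
    then show ?case using it[of "Suc m"] by (simp add: R_def expand_iteration_def)
  qed
  have ?pattern
    using it[of "Suc _"] by (auto simp: S expand_iteration_def)
  moreover have ?shift
    using S3 S1 S[of 2] by (simp add: initial_state_def eval_nat_numeral)
  ultimately show "?pattern \<and> ?shift" ..
next
  assume R: "?pattern \<and> ?shift"
  show "cycles_2_6 \<tau> u N c"
    unfolding cycles_2_6_def
  \<comment> \<open>The pattern does not constrain index 0, where \<open>n - 1\<close>
    truncates.\<close>
  proof (intro exI[of _ "\<lambda>n. R (n - 1)"] conjI allI impI)
    show "R (1 - 1) = initial_state N c"
      by (simp add: R_def)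
    show "tableau (R (3 - 1)) = (\<chi> i j. tableau (R (1 - 1)) $ i $ (j - 2))"
      using R by (simp add: R_def initial_state_def)
  next
    fix n :: nat assume "1 \<le> n"
    then obtain m where n: "n = Suc m" by (metis Suc_le_D One_nat_def)
    show "entering_columns (tableau (R (n - 1))) = {of_nat n}"
      using R by (simp add: n)
    show "expand_iteration \<tau> u n (R (n - 1)) (of_nat n) (if odd n then 1 else 2) (R (Suc n - 1))"
      using R by (auto simp: n expand_iteration_def R_def)
  qed
qed

section \<open>Coefficients of 2/6-cycles\<close>

text \<open>The tableau of condition (i). Its leading block A has trace -1; once
  \<open>- c * b = 1 + a + a\<^sup>2\<close>, A has determinant 1 and columns 3 and 4 of the
  constraint rows hold its inverse.\<close>

definition cyc_tableau :: "real \<Rightarrow> real \<Rightarrow> real \<Rightarrow> real \<Rightarrow> real^6^3" where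
  "cyc_tableau a b c \<mu> = vector
     [vector [a, b, - (a + 1), - b, 1, 0],
      vector [c, - (a + 1), - c, a, 0, 1],
      vector [-1, \<mu>, - (a + 1) + \<mu> * c, - b - \<mu> * a, 0, 0]]"

text \<open>
  The rows 1 and 2 have basic variables 5 and 6 (index 0) with values \<open>X\<close> and \<open>Y\<close>; \<open>w\<close> and \<open>w'\<close> are
  the values with which the nonbasic variables 1 and 3 left the basis.
\<close>
definition cyc_state :: "real^6^3 \<Rightarrow> 6 \<Rightarrow> real \<Rightarrow> real \<Rightarrow> real \<Rightarrow> real \<Rightarrow> simplex_state" where
  "cyc_state T z X Y w w' =
     \<lparr> tableau = T, basis = (\<lambda>i. if i = 1 then 5 else if i = 2 then 0 else z),
       vals = vector [w, 0, w', 0, X, Y] \<rparr>"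

text \<open>The relation between \<open>b\<close> and \<open>c\<close> makes the next pivot element,
  in row 2 and column 2, equal to \<open>1 / a\<close>.\<close>

lemma pivot_1_1:
  assumes "a > 0" "- c * b = 1 + a + a\<^sup>2"
  shows "gauss_jordan_pivot (cyc_tableau a b c \<mu>) 1 1 = vector
     [vector [1, b / a, - (a + 1) / a, - b / a, 1 / a, 0],
      vector [0, 1 / a, c / a, - (a + 1) / a, - c / a, 1],
      vector [0, \<mu> + b / a, - (a + 1) + \<mu> * c - (a + 1) / a, - b - \<mu> * a - b / a, 1 / a, 0]]"
proof -
  have bc: "b * c = - 1 - a - a * a"
    using assms by (simp add: power2_eq_square mult.commute)
  show ?thesis
    using assms(1)
    by (simp add: gauss_jordan_pivot_def cyc_tableau_def vec_eq_iff forall_3 forall_6 field_simps)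
       (simp add: bc algebra_simps)
qed

text \<open>The two pivots multiply the constraint rows by the inverse of the leading block, written
  here as adjugate over \<open>D\<close>; row 3 is then cleared in columns 1 and 2.\<close>

lemma double_pivot_nth:
  fixes M :: "real^6^3"
  defines "D \<equiv> M$1$1 * M$2$2 - M$1$2 * M$2$1"
  defines "P \<equiv> gauss_jordan_pivot (gauss_jordan_pivot M 1 1) 2 2"
  assumes "M$1$1 \<noteq> 0" "D \<noteq> 0"
  shows "P$1$j = (M$2$2 * M$1$j - M$1$2 * M$2$j) / D"
    and "P$2$j = (M$1$1 * M$2$j - M$2$1 * M$1$j) / D"
    and "P$3$j = M$3$j - M$3$1 * P$1$j - M$3$2 * P$2$j"
proof -
  \<comment> \<open>\<open>q\<close> is the second pivot element, so \<open>D\<close> is the product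
    of the two pivot elements.\<close>
  define q where "q = M$2$2 - M$2$1 * (M$1$2 / M$1$1)"
  have D: "D = M$1$1 * q"
    using assms by (simp add: q_def field_simps)
  then have q: "q \<noteq> 0"
    using assms(4) by auto
  have P2: "P$2$j = (M$2$j - M$2$1 * (M$1$j / M$1$1)) / q" for j
    by (simp add: P_def gauss_jordan_pivot_def q_def)
  have P1: "P$1$j = M$1$j / M$1$1 - M$1$2 / M$1$1 * P$2$j" for j
    by (simp add: P_def gauss_jordan_pivot_def)
  have P3: "P$3$j = M$3$j - M$3$1 * (M$1$j / M$1$1) - (M$3$2 - M$3$1 * (M$1$2 / M$1$1)) * P$2$j" for j
    by (simp add: P_def gauss_jordan_pivot_def)
  show P2': "P$2$j = (M$1$1 * M$2$j - M$2$1 * M$1$j) / D"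
    unfolding P2 D using q assms(3) by (simp add: field_simps)
  have "M$1$1 * P$1$j = M$1$j - M$1$2 * P$2$j"
    using assms(3) by (simp add: P1 field_simps)
  also have "\<dots> = M$1$1 * ((M$2$2 * M$1$j - M$1$2 * M$2$j) / D)"
    unfolding P2' using assms(4) by (simp add: field_simps) (simp add: D_def algebra_simps)
  finally show "P$1$j = (M$2$2 * M$1$j - M$1$2 * M$2$j) / D"
    using assms(3) by (metis mult_left_cancel)
  show "P$3$j = M$3$j - M$3$1 * P$1$j - M$3$2 * P$2$j"
    unfolding P3 P1 by (simp add: algebra_simps)
qed

text \<open>Trace -1 and determinant 1 give A^3 = I, so multiplying \<open>[A | B | I]\<close> by
  the inverse of A only permutes the blocks.\<close>

lemma pivot_2_2:
  assumes "a > 0" "- c * b = 1 + a + a\<^sup>2"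
  shows "gauss_jordan_pivot (gauss_jordan_pivot (cyc_tableau a b c \<mu>) 1 1) 2 2 =
    (\<chi> i j. cyc_tableau a b c \<mu> $ i $ (j - 2))"
proof -
  have bc: "b * c = - 1 - a - a * a"
    using assms by (simp add: power2_eq_square mult.commute)
  show ?thesis
    unfolding pivot_1_1[OF assms]
    using assms(1)
    by (simp add: gauss_jordan_pivot_def cyc_tableau_def vec_eq_iff forall_3 forall_6 field_simps)
       (simp add: bc algebra_simps)
qed

text \<open>Comparing blocks gives B = A^(-1) and A = A^(-1) B. The entries of this matrix equation
  determine trace and determinant of A, and then all coefficients.\<close>

lemma initial_tableau_eq_cyc_tableau:
  fixes N c
  defines "M \<equiv> initial_tableau N c"
  assumes "M$1$1 > 0" "gauss_jordan_pivot M 1 1 $ 2 $ 2 > 0" "M$2$1 \<noteq> 0" "M$3$1 = -1"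
    and shift: "gauss_jordan_pivot (gauss_jordan_pivot M 1 1) 2 2 = (\<chi> i j. M $ i $ (j - 2))"
  shows "M = cyc_tableau (M$1$1) (M$1$2) (M$2$1) (M$3$2)"
    and "- (M$2$1) * M$1$2 = 1 + M$1$1 + (M$1$1)\<^sup>2"
proof -
  define D where "D = M$1$1 * M$2$2 - M$1$2 * M$2$1"
  have "D = M$1$1 * gauss_jordan_pivot M 1 1 $ 2 $ 2"
    using assms(2) by (simp add: D_def gauss_jordan_pivot_def field_simps)
  then have D: "D > 0"
    using assms(2,3) by simp
  have id: "M$1$5 = 1" "M$1$0 = 0" "M$2$5 = 0" "M$2$0 = 1" "M$3$5 = 0" "M$3$0 = 0"
    by (simp_all add: M_def initial_tableau_def)
  have P: "M$1$(j - 2) = (M$2$2 * M$1$j - M$1$2 * M$2$j) / D"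
      "M$2$(j - 2) = (M$1$1 * M$2$j - M$2$1 * M$1$j) / D"
      "M$3$(j - 2) = M$3$j + M$1$(j - 2) - M$3$2 * M$2$(j - 2)" for j
    using double_pivot_nth[of M j, folded D_def] assms(2,5) D unfolding shift
    by (simp_all add: diff_divide_distrib)
  have B: "M$1$3 = M$2$2 / D" "M$1$4 = - M$1$2 / D" "M$2$3 = - M$2$1 / D" "M$2$4 = M$1$1 / D"
    using P(1,2)[of 5] P(1,2)[of 0] by (simp_all add: id)
  have A: "M$1$1 * D = M$2$2 * M$1$3 - M$1$2 * M$2$3" "M$1$2 * D = M$2$2 * M$1$4 - M$1$2 * M$2$4"
    "M$2$1 * D = M$1$1 * M$2$3 - M$2$1 * M$1$3" "M$2$2 * D = M$1$1 * M$2$4 - M$2$1 * M$1$4"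
    using P(1,2)[of 3] P(1,2)[of 4] D by (simp_all add: field_simps)
  have BD: "M$1$3 * D = M$2$2" "M$1$4 * D = - M$1$2" "M$2$3 * D = - M$2$1" "M$2$4 * D = M$1$1"
    using D by (simp_all add: B)
  have AD: "M$1$1 * D\<^sup>2 = M$2$2 * (M$1$3 * D) - M$1$2 * (M$2$3 * D)"
    "M$1$2 * D\<^sup>2 = M$2$2 * (M$1$4 * D) - M$1$2 * (M$2$4 * D)"
    "M$2$1 * D\<^sup>2 = M$1$1 * (M$2$3 * D) - M$2$1 * (M$1$3 * D)"
    "M$2$2 * D\<^sup>2 = M$1$1 * (M$2$4 * D) - M$2$1 * (M$1$4 * D)"
    by (simp_all only: power2_eq_square mult.assoc[symmetric] A left_diff_distrib)
  \<comment> \<open>Entrywise, D^2 A is the square of the adjugate of A.\<close>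
  have A2: "M$1$1 * D\<^sup>2 = (M$2$2)\<^sup>2 + M$1$2 * M$2$1" "M$1$2 * D\<^sup>2 = - M$1$2 * (M$1$1 + M$2$2)"
    "M$2$1 * D\<^sup>2 = - M$2$1 * (M$1$1 + M$2$2)" "M$2$2 * D\<^sup>2 = (M$1$1)\<^sup>2 + M$1$2 * M$2$1"
    unfolding AD BD by (simp_all add: power2_eq_square algebra_simps)
  \<comment> \<open>An off-diagonal entry yields the trace because \<open>M$2$1\<close> can be
    cancelled.\<close>
  have tr: "M$1$1 + M$2$2 = - D\<^sup>2"
  proof -
    have "M$2$1 * (D\<^sup>2 + (M$1$1 + M$2$2)) = 0"
      unfolding distrib_left A2(3) by simp
    then show ?thesis
      using assms(4) by simp
  qed
  \<comment> \<open>Taking determinants in D^2 A = adj(A)^2 gives D^5 = D^2.\<close>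
  have "D\<^sup>2 * D ^ 3 = D\<^sup>2 * D\<^sup>2 * (M$1$1 * M$2$2 - M$1$2 * M$2$1)"
    by (simp add: D_def[symmetric] eval_nat_numeral)
  also have "\<dots> = (M$1$1 * D\<^sup>2) * (M$2$2 * D\<^sup>2) - (M$1$2 * D\<^sup>2) * (M$2$1 * D\<^sup>2)"
    by (simp add: algebra_simps)
  also have "\<dots> = (M$1$1 * M$2$2 - M$1$2 * M$2$1)\<^sup>2"
    unfolding A2 by (simp add: power2_eq_square algebra_simps)
  also have "\<dots> = D\<^sup>2"
    by (simp add: D_def)
  finally have "D\<^sup>2 * D ^ 3 = D\<^sup>2 * 1"
    by (simp only: mult_1_right)
  then have "D ^ 3 = 1"
    using D by (subst (asm) mult_left_cancel) simp_all
  then have D1: "D = 1"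
    using D by (metis less_eq_real_def power_eq_1_iff zero_neq_numeral abs_of_pos real_norm_def)
  have d: "M$2$2 = - (M$1$1 + 1)"
    using tr D1 by simp
  show "- (M$2$1) * M$1$2 = 1 + M$1$1 + (M$1$1)\<^sup>2"
    using D1 unfolding D_def d by (simp add: algebra_simps power2_eq_square)
  \<comment> \<open>The slack columns 5 and 6 have zero reduced cost, so they determine the reduced
    costs of columns 3 and 4.\<close>
  have "M$3$3 = M$1$3 - M$3$2 * M$2$3" "M$3$4 = M$1$4 - M$3$2 * M$2$4"
    using P(3)[of 5] P(3)[of 0] by (simp_all add: id)
  then show "M = cyc_tableau (M$1$1) (M$1$2) (M$2$1) (M$3$2)"
    using assms(5) by (simp add: vec_eq_iff forall_3 forall_6 cyc_tableau_def id B D1 d)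
qed

section \<open>The column rule in the first two iterations\<close>

lemma entering_columns_eq_singleton_iff:
  "entering_columns M = {k} \<longleftrightarrow> M$3$k < 0 \<and> (\<forall>j. j \<noteq> k \<longrightarrow> M$3$k < M$3$j)"
proof
  assume *: "entering_columns M = {k}"
  then have "k \<in> entering_columns M" by simp
  then have k: "M$3$k < 0" "\<And>j. M$3$k \<le> M$3$j"
    by (auto simp: entering_columns_def)
  moreover have "M$3$k \<noteq> M$3$j" if "j \<noteq> k" for j
    using * k that by (auto simp: entering_columns_def)
  ultimately show "M$3$k < 0 \<and> (\<forall>j. j \<noteq> k \<longrightarrow> M$3$k < M$3$j)"
    by (simp add: order_less_le)
next
  assume *: "M$3$k < 0 \<and> (\<forall>j. j \<noteq> k \<longrightarrow> M$3$k < M$3$j)"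
  then have "M$3$k \<le> M$3$j" for j
    by (cases "j = k") auto
  moreover have "\<not> M$3$j \<le> M$3$k" if "j \<noteq> k" for j
    using * that by (simp add: not_le)
  ultimately show "entering_columns M = {k}"
    using * by (auto simp: entering_columns_def)
qed

lemma entering_cyc_tableau_iff:
  "entering_columns (cyc_tableau a b c \<mu>) = {1} \<longleftrightarrow>
     -1 < \<mu> \<and> a < \<mu> * c \<and> b + \<mu> * a < 1"
  by (auto simp: entering_columns_eq_singleton_iff cyc_tableau_def forall_6)

lemma entering_pivot_cyc_tableau_iff:
  assumes "a > 0" "- c * b = 1 + a + a\<^sup>2"
  shows "entering_columns (gauss_jordan_pivot (cyc_tableau a b c \<mu>) 1 1) = {2} \<longleftrightarrow>
     \<mu> + b / a < 0 \<and> \<mu> + b / a < - (a + 1) + \<mu> * c - (a + 1) / a \<and>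
     \<mu> + b / a < - b - \<mu> * a - b / a \<and> \<mu> + b / a < 1 / a"
  unfolding pivot_1_1[OF assms]
  by (auto simp: entering_columns_eq_singleton_iff forall_6)

section \<open>Variable values and row choice in one pair of pivots\<close>

text \<open>As \<open>X \<le> 0\<close>, the full step is not positive and the minimal step is
  taken; the leaving variable drops by exactly \<open>\<tau>\<close>.\<close>

lemma next_state_cyc_1:
  assumes "a > 0" "\<tau> > 0" "X \<le> 0"
  shows "next_state \<tau> (cyc_state (cyc_tableau a b c \<mu>) z (\<tau> * X) (\<tau> * Y) (\<tau> * w) (\<tau> * w')) 1 1 =
    \<lparr> tableau = gauss_jordan_pivot (cyc_tableau a b c \<mu>) 1 1,
      basis = (\<lambda>i. if i = 1 then 1 else if i = 2 then 0 else z),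
      vals = vector [\<tau> * (w + 1 / a), 0, \<tau> * w', 0, \<tau> * (X - 1), \<tau> * (Y - c / a)] \<rparr>"
proof -
  have "\<tau> * X \<le> 0"
    using assms by (simp add: mult_nonneg_nonpos)
  then have "max (\<tau> / a) (\<tau> * X / a) = \<tau> / a"
    using assms by (intro max_absorb1 divide_right_mono) auto
  then show ?thesis
    using assms(1)
    by (auto simp: next_state_def cyc_state_def step_length_def move_nth vec_eq_iff forall_6
        cyc_tableau_def fun_eq_iff field_simps)
qed

text \<open>In the second pivot the full step is taken, so the leaving variable becomes 0. Hence
  only variables leaving from row 1 carry nonzero values out of the basis, and \<open>w\<close>,
  \<open>w'\<close> suffice to record them.\<close>

lemma next_state_cyc_2:
  fixes a b c \<mu> \<tau> X Y w w' :: real and z :: 6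
  assumes "a > 0" "b > 0" "- c * b = 1 + a + a\<^sup>2" "a \<le> - c" "\<tau> > 0" "X \<le> 0" "Y \<ge> 0"
  defines "S \<equiv> cyc_state (cyc_tableau a b c \<mu>) z (\<tau> * X) (\<tau> * Y) (\<tau> * w) (\<tau> * w')"
  shows "next_state \<tau> (next_state \<tau> S 1 1) 2 2 = shift_state 2
    (cyc_state (cyc_tableau a b c \<mu>) (z - 2)
      (\<tau> * (w - b * Y - (1 + a))) (\<tau> * (a * Y - c)) (\<tau> * w') (\<tau> * (X - 1)))"
proof -
  have bc: "b * c = - 1 - a - a * a"
    using assms by (simp add: power2_eq_square mult.commute)
  \<comment> \<open>The full step is at least the minimal one iff \<open>Y - c / a \<ge> 1\<close>,
    which follows from \<open>a \<le> - c\<close>.\<close>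
  have "a * 1 \<le> a * (Y - c / a)"
    using assms(1,4,7) by (simp add: right_diff_distrib) (smt (verit) mult_nonneg_nonneg)
  then have "1 \<le> Y - c / a"
    using assms(1) by (simp only: mult_le_cancel_left_pos)
  then have "\<tau> * 1 \<le> \<tau> * (Y - c / a)"
    using assms by (intro mult_left_mono) auto
  then have "max (\<tau> / (1 / a)) (\<tau> * (Y - c / a) / (1 / a)) = \<tau> * (Y - c / a) / (1 / a)"
    using assms by (intro max_absorb2 divide_right_mono) auto
  also have "\<dots> = \<tau> * (a * Y - c)"
    using assms by (simp add: field_simps)
  finally have step: "max (\<tau> / (1 / a)) (\<tau> * (Y - c / a) / (1 / a)) = \<tau> * (a * Y - c)" .
  have new1: "\<tau> * (w + 1 / a) - \<tau> * (a * Y - c) * (b / a) = \<tau> * (w - b * Y - (1 + a))"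
    using assms(1) by (simp add: field_simps bc)
  have new2: "\<tau> * (Y - c / a) - \<tau> * (a * Y - c) * (1 / a) = 0"
    using assms(1) by (simp add: field_simps)
  let ?S' = "next_state \<tau> S 1 1"
  have S': "?S' = \<lparr> tableau = gauss_jordan_pivot (cyc_tableau a b c \<mu>) 1 1,
      basis = (\<lambda>i. if i = 1 then 1 else if i = 2 then 0 else z),
      vals = vector [\<tau> * (w + 1 / a), 0, \<tau> * w', 0, \<tau> * (X - 1), \<tau> * (Y - c / a)] \<rparr>"
    unfolding S_def using assms by (intro next_state_cyc_1)
  have col: "gauss_jordan_pivot (cyc_tableau a b c \<mu>) 1 1 $ 1 $ 2 = b / a"
      "gauss_jordan_pivot (cyc_tableau a b c \<mu>) 1 1 $ 2 $ 2 = 1 / a"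
    unfolding pivot_1_1[OF assms(1,3)] by simp_all
  have "step_length \<tau> ?S' 2 2 = \<tau> * (a * Y - c)"
    unfolding step_length_def S' using step by (simp add: col)
  then have "move ?S' 2 (step_length \<tau> ?S' 2 2) = vector
      [\<tau> * (w - b * Y - (1 + a)), \<tau> * (a * Y - c), \<tau> * w', 0, \<tau> * (X - 1), 0]"
    using new1 new2 unfolding S' by (simp add: vec_eq_iff forall_6 move_nth col)
  then show ?thesis
    unfolding next_state_def[of _ ?S']
    by (simp add: S' pivot_2_2[OF assms(1,3)] shift_state_def cyc_state_def vec_eq_iff forall_6 fun_eq_iff)
qed

lemma leaving_row_cyc_1:
  assumes "a > 0" "c \<le> 0" "\<delta> \<ge> 0"
  shows "leaving_row \<delta> (cyc_state (cyc_tableau a b c \<mu>) z x y v v') 1 1"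
  using assms by (intro leaving_row_1I) (simp_all add: cyc_state_def cyc_tableau_def)

text \<open>\<open>w - b * Y - (1 + a)\<close> is the value, in units of \<open>\<tau>\<close>, that
  the full step gives to the basic variable of row 1. For the converse, \<open>b < 1\<close> makes
  the entry \<open>1 / a\<close> of row 2 larger than \<open>b / a\<close>.\<close>

lemma leaving_row_cyc_2:
  fixes a b c \<mu> \<tau> X Y w w' :: real and z :: 6
  assumes "a > 0" "b > 0" "- c * b = 1 + a + a\<^sup>2" "\<tau> > 0" "X \<le> 0"
  defines "S \<equiv> cyc_state (cyc_tableau a b c \<mu>) z (\<tau> * X) (\<tau> * Y) (\<tau> * w) (\<tau> * w')"
  shows "leaving_row (\<tau> * d) (next_state \<tau> S 1 1) 2 2 \<Longrightarrow> 0 \<le> w - b * Y - (1 + a) + d"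
    and "0 \<le> w - b * Y - (1 + a) + d \<Longrightarrow> b < 1 \<Longrightarrow> d \<ge> 0 \<Longrightarrow>
      leaving_row (\<tau> * d) (next_state \<tau> S 1 1) 2 2"
proof -
  have bc: "b * c = - 1 - a - a * a"
    using assms by (simp add: power2_eq_square mult.commute)
  let ?S' = "next_state \<tau> S 1 1"
  have S': "?S' = \<lparr> tableau = gauss_jordan_pivot (cyc_tableau a b c \<mu>) 1 1,
      basis = (\<lambda>i. if i = 1 then 1 else if i = 2 then 0 else z),
      vals = vector [\<tau> * (w + 1 / a), 0, \<tau> * w', 0, \<tau> * (X - 1), \<tau> * (Y - c / a)] \<rparr>"
    unfolding S_def using assms by (intro next_state_cyc_1)
  have col: "tableau ?S' $ 1 $ 2 = b / a" "tableau ?S' $ 2 $ 2 = 1 / a"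
    unfolding S' pivot_1_1[OF assms(1,3)] by simp_all
  have vals: "vals ?S' $ basis ?S' 2 = \<tau> * (Y - c / a)" "vals ?S' $ basis ?S' 1 = \<tau> * (w + 1 / a)"
    by (simp_all add: S')
  have sides: "\<tau> * (Y - c / a) / (1 / a) = \<tau> * (a * Y - c)"
      "(\<tau> * (w + 1 / a) + \<tau> * d) / (b / a) = \<tau> * ((a * w + 1 + a * d) / b)"
    using assms(1,2) by (simp_all add: field_simps)
  have "vals ?S' $ basis ?S' 2 / (1 / a) \<le> (vals ?S' $ basis ?S' 1 + \<tau> * d) / (b / a) \<longleftrightarrow>
      \<tau> * (a * Y - c) \<le> \<tau> * ((a * w + 1 + a * d) / b)"
    unfolding vals sides ..
  also have "\<dots> \<longleftrightarrow> a * Y - c \<le> (a * w + 1 + a * d) / b"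
    using \<open>\<tau> > 0\<close> by (simp only: mult_le_cancel_left_pos)
  also have "\<dots> \<longleftrightarrow> a * (b * Y) - b * c \<le> a * w + 1 + a * d"
    using assms(2) by (simp add: field_simps)
  also have "\<dots> \<longleftrightarrow> 0 \<le> a * (w - b * Y - (1 + a) + d)"
    unfolding bc by (simp add: algebra_simps)
  also have "\<dots> \<longleftrightarrow> 0 \<le> w - b * Y - (1 + a) + d"
    using assms(1) by (simp add: zero_le_mult_iff)
  finally have ratio: "vals ?S' $ basis ?S' 2 / (1 / a) \<le> (vals ?S' $ basis ?S' 1 + \<tau> * d) / (b / a) \<longleftrightarrow>
      0 \<le> w - b * Y - (1 + a) + d" .
  show "0 \<le> w - b * Y - (1 + a) + d" if "leaving_row (\<tau> * d) ?S' 2 2"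
  proof -
    have "2 \<in> eligible_rows (\<tau> * d) ?S' 2"
      using that by (simp add: leaving_row_def)
    then show ?thesis
      using assms(1,2) unfolding ratio[symmetric] mem_eligible_rows_iff
      by (auto simp: col)
  qed
  show "leaving_row (\<tau> * d) ?S' 2 2" if "0 \<le> w - b * Y - (1 + a) + d" "b < 1" "d \<ge> 0"
    using that assms(1,2,4) ratio by (subst leaving_row_2_iff) (simp_all add: col divide_strict_right_mono)
qed

section \<open>Growth of the basic values\<close>

text \<open>
  In units of \<open>\<tau>\<close>, \<open>row1_level a m\<close> and \<open>row2_level a m / b\<close> are the values of the basic variables
  of rows 1 and 2 after \<open>2 m\<close> iterations.  The summand \<open>row1_level a (m - 2) - 1\<close> is the value with
  which the variable entering row 1 left the basis four iterations earlier.
\<close>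
primrec row2_level :: "real \<Rightarrow> nat \<Rightarrow> real" where
  "row2_level a 0 = 0"
| "row2_level a (Suc m) = a * row2_level a m + (1 + a + a\<^sup>2)"

fun row1_level :: "real \<Rightarrow> nat \<Rightarrow> real" where
  "row1_level a 0 = 0"
| "row1_level a (Suc m) =
     (if m < 2 then 0 else row1_level a (m - 2) - 1) - row2_level a m - (1 + a)"

lemma row2_level_nonneg: "a \<ge> 0 \<Longrightarrow> row2_level a m \<ge> 0"
  by (induction m) auto

lemma row1_level_nonpos: "a \<ge> 0 \<Longrightarrow> row1_level a m \<le> 0"
proof (induction a m rule: row1_level.induct)
  case (2 a m)
  then show ?case using row2_level_nonneg[of a m] by auto
qed simp

text \<open>Three pairs of pivots lower the level by at most \<open>1 + (4 - a) + (1 + a)\<close>,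
  which is 6.\<close>

lemma row1_level_lower_bound:
  assumes "0 \<le> a" "a \<le> 1/2"
  shows "- 2 * real m \<le> row1_level a m"
proof (induction m rule: less_induct)
  case (less m)
  \<comment> \<open>The bound \<open>4 - a\<close> is preserved since
    \<open>a * (4 - a) + 1 + a + a\<^sup>2 = 1 + 5 * a\<close>, which is at most
    \<open>4 - a\<close> for \<open>a \<le> 1/2\<close>.\<close>
  have row2: "row2_level a k \<le> 4 - a" for k
  proof (induction k)
    case (Suc k)
    have "a * row2_level a k \<le> a * (4 - a)"
      using Suc assms by (intro mult_left_mono) auto
    then show ?case
      using assms by (simp add: power2_eq_square algebra_simps)
  qed (use assms in simp)
  have sq: "a\<^sup>2 \<le> 1/4"
    using power_mono[OF assms(2,1), of 2] by (simp add: power2_eq_square)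
  consider "m = 0" | "m = 1" | "m = 2" | k where "m = Suc (Suc (Suc k))"
    by (metis One_nat_def numeral_2_eq_2 not0_implies_Suc)
  then show ?case
  proof cases
    case 4
    then show ?thesis
      using less[of k] row2[of "Suc (Suc k)"] by (simp del: row2_level.simps)
  qed (use assms sq in \<open>simp_all add: numeral_2_eq_2\<close>)
qed

text \<open>Otherwise the slacks are all nonnegative. Adding three consecutive ones turns the
  recursion with delay three into one of first order, and that sum would eventually be
  negative.\<close>

lemma row1_level_unbounded:
  assumes "a > 1/2"
  obtains m where "row1_level a m < - (u + 2 * real m)"
proof (rule ccontr)
  assume "\<not> thesis"
  with that have D: "row1_level a m + u + 2 * real m \<ge> 0" for m
    by (smt (verit))
  (* The quantity (1 - a) * W m - row2_level a (m + 2) changes by 3 - 6 * a in each step. *)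
  define W where "W m = (\<Sum>i<3. row1_level a (m + i) + u + 2 * real (m + i))" for m
  have W_nonneg: "W m \<ge> 0" for m
    unfolding W_def by (intro sum_nonneg D)
  have W_Suc: "W (Suc m) = W m + (4 - a - row2_level a (m + 2))" for m
    by (simp add: W_def eval_nat_numeral)
  show False
  proof (cases "a < 1")
    case True
    have "(1 - a) * W m - row2_level a (m + 2) =
        (1 - a) * W 0 - row2_level a 2 - real m * (6 * a - 3)" for m
    proof (induction m)
      case (Suc m)
      then show ?case
        by (simp add: W_Suc del: row2_level.simps(1)) (simp add: algebra_simps power2_eq_square)
    qed (simp add: numeral_2_eq_2)
    \<comment> \<open>The bound is the fixed point of the recursion for
      \<open>row2_level\<close>.\<close>
    moreover have "row2_level a m \<le> (1 + a + a\<^sup>2) / (1 - a)" for m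
    proof (induction m)
      case 0
      then show ?case using True assms by (auto intro!: divide_nonneg_pos add_nonneg_nonneg)
    next
      case (Suc m)
      have "a * row2_level a m \<le> a * ((1 + a + a\<^sup>2) / (1 - a))"
        using Suc assms by (intro mult_left_mono) auto
      then show ?case
        using True by (simp add: field_simps)
    qed
    moreover obtain m where
      "(1 - a) * W 0 - row2_level a 2 + (1 + a + a\<^sup>2) / (1 - a) < real m * (6 * a - 3)"
      using reals_Archimedean3[of "6 * a - 3"] assms by auto
    moreover have "(1 - a) * W m \<ge> 0"
      using W_nonneg True by simp
    ultimately show False
      by (smt (verit))
  next
    case False
    have row2: "row2_level a m \<ge> 3 * real m" for m
    proof (induction m)
      case (Suc m)
      have "1 * (3 * real m) \<le> a * row2_level a m"
        using False Suc by (intro mult_mono) auto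
      moreover have "1 + 1 + 1 \<le> 1 + a + a\<^sup>2"
        using False by (intro add_mono) auto
      ultimately have "1 * (3 * real m) + (1 + 1 + 1) \<le> row2_level a (Suc m)"
        unfolding row2_level.simps by (rule add_mono)
      then show ?case
        by (simp del: row2_level.simps)
    qed simp
    \<comment> \<open>Each increment \<open>4 - a - row2_level a (m + 2)\<close> is at most 3 -
      6.\<close>
    have "W m \<le> W 0 - 3 * real m" for m
    proof (induction m)
      case (Suc m)
      then show ?case
        using W_Suc[of m] row2[of "m + 2"] False by simp
    qed simp
    moreover obtain m where "W 0 < real m * 3"
      using reals_Archimedean3[of 3] by auto
    ultimately show False
      using W_nonneg[of m] by (smt (verit))
  qed
qed

section \<open>The whole run and the bounds on \<open>\<mu>\<close>\<close>

text \<open>Each pair of pivots shifts the columns by two more places. The argument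
  \<open>- of_nat (2 * m)\<close> compensates the shift, keeping the \<open>basis\<close> entry at
  row 3 constant.\<close>

lemma pattern_run_cyc:
  fixes a b c \<mu> \<tau> :: real
  assumes "a > 0" "b > 0" "- c * b = 1 + a + a\<^sup>2" "a \<le> - c" "\<tau> > 0"
  defines "T \<equiv> cyc_tableau a b c \<mu>"
  defines "w \<equiv> \<lambda>m. if m < 2 then 0 else row1_level a (m - 2) - 1"
  shows "pattern_run \<tau> (cyc_state T 0 0 0 0 0) (2 * m) = shift_state (of_nat (2 * m))
    (cyc_state T (- of_nat (2 * m)) (\<tau> * row1_level a m) (\<tau> * (row2_level a m / b))
      (\<tau> * w m) (\<tau> * w (Suc m)))"
proof (induction m)
  case 0
  then show ?case by (simp add: w_def)
next
  case (Suc m)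
  let ?s = "of_nat (2 * m) :: 6"
  let ?S = "cyc_state T (- ?s) (\<tau> * row1_level a m) (\<tau> * (row2_level a m / b))
      (\<tau> * w m) (\<tau> * w (Suc m))"
  have bc: "b * c = - (1 + a + a\<^sup>2)"
    using assms by (simp add: mult.commute)
  have row2: "a * (row2_level a m / b) - c = row2_level a (Suc m) / b"
    using assms(2) by (simp add: field_simps) (simp add: bc)
  have "pattern_run \<tau> (cyc_state T 0 0 0 0 0) (2 * Suc m) =
      next_state \<tau> (next_state \<tau> (shift_state ?s ?S) (1 + ?s) 1) (2 + ?s) 2"
    using Suc.IH by (simp add: add.assoc[symmetric])
  also have "\<dots> = shift_state ?s (next_state \<tau> (next_state \<tau> ?S 1 1) 2 2)"
    by (simp only: next_state_shift)
  also have "\<dots> = shift_state ?s (shift_state 2 (cyc_state T (- ?s - 2)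
      (\<tau> * (w m - b * (row2_level a m / b) - (1 + a))) (\<tau> * (a * (row2_level a m / b) - c))
      (\<tau> * w (Suc m)) (\<tau> * (row1_level a m - 1))))"
    unfolding T_def using assms row1_level_nonpos[of a m] row2_level_nonneg[of a m]
    by (subst next_state_cyc_2) simp_all
  also have "\<dots> = shift_state (of_nat (2 * Suc m)) (cyc_state T (- of_nat (2 * Suc m))
      (\<tau> * row1_level a (Suc m)) (\<tau> * (row2_level a (Suc m) / b)) (\<tau> * w (Suc m)) (\<tau> * w (Suc (Suc m))))"
  proof -
    have "?s + 2 = of_nat (2 * Suc m)" "- ?s - 2 = - of_nat (2 * Suc m)"
      by (simp_all add: algebra_simps del: minus_6)
    \<comment> \<open>A variable leaving row 1 reenters there two pairs later, with the value
      \<open>row1_level a m - 1\<close> at which it left.\<close>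
    moreover have "w m - b * (row2_level a m / b) - (1 + a) = row1_level a (Suc m)"
      "row1_level a m - 1 = w (Suc (Suc m))"
      using assms(2) by (simp_all add: w_def)
    ultimately show ?thesis
      by (simp only: row2 shift_state_add)
  qed
  finally show ?case .
qed

text \<open>This form of the bound is what comparing columns 2 and 4 in iteration 2
  produces.\<close>

lemma bound_times_Suc:
  fixes a b :: real
  assumes "a > 0"
  shows "b * (a + 2) / (a * (a + 1)) * (a + 1) = b + 2 * (b / a)"
proof -
  have "b * (a + 2) / (a * (a + 1)) * (a + 1) = b * (a + 2) / a"
    using assms unfolding divide_divide_eq_left[symmetric] by simp
  then show ?thesis
    using assms by (simp add: field_simps)
qed

text \<open>Apart from \<open>-1 < \<mu>\<close>, every inequality of the column rule bounds
  \<open>\<mu>\<close> from above; the one for column 4 in iteration 2 is the strongest and gives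
  \<open>\<mu> < - k\<close>.\<close>

lemma entering_columns_bounds:
  fixes a b c \<mu> :: real
  assumes "a > 0" "b > 0" "- c * b = 1 + a + a\<^sup>2" "a \<le> 1/2"
    and \<mu>: "-1 < \<mu>" "\<mu> < - (b * (a + 2) / (a * (a + 1)))"
  shows "entering_columns (cyc_tableau a b c \<mu>) = {1}"
    and "entering_columns (gauss_jordan_pivot (cyc_tableau a b c \<mu>) 1 1) = {2}"
proof -
  define k where "k = b * (a + 2) / (a * (a + 1))"
  have k: "k > 0" "\<mu> < - k"
    using assms by (simp_all add: k_def)
  have c: "- c = (1 + a + a\<^sup>2) / b"
    using assms by (simp add: field_simps)
  have "- c > 0"
    unfolding c using assms by (intro divide_pos_pos add_pos_pos) auto
  have aa: "a * (a + 1) > 0"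
    using assms by simp
  have "a * (a + 1) * a < (a + 2) * (1 + a + a\<^sup>2)"
    using assms by (simp add: algebra_simps power2_eq_square add_pos_pos)
  then have "a < (a + 2) * (1 + a + a\<^sup>2) / (a * (a + 1))"
    using aa by (simp add: pos_less_divide_eq mult.commute)
  also have "\<dots> = k * (- c)"
    unfolding c k_def using assms by simp
  also have "\<dots> < (- \<mu>) * (- c)"
    using k \<open>- c > 0\<close> by (intro mult_strict_right_mono) auto
  finally have 1: "a < \<mu> * c"
    by simp
  have "b < 1"
  proof -
    have "b * (a + 2) / (a * (a + 1)) < 1"
      using \<mu> by simp
    then have "b * (a + 2) < a * (a + 1)"
      using aa by simp
    also have "\<dots> \<le> 1/2 * (a + 2)"
      using assms by (intro mult_mono) auto
    finally show ?thesis
      using assms by simp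
  qed
  moreover have "\<mu> * a \<le> 0"
    using k assms by (simp add: mult_nonpos_nonneg)
  ultimately have 2: "b + \<mu> * a < 1"
    by simp
  have ka: "k * (a + 1) = b + 2 * (b / a)"
    unfolding k_def using bound_times_Suc[OF assms(1)] .
  have "(a + 1) * (k - b / a) = k * (a + 1) - b - b / a"
    using assms(1) by (simp add: field_simps)
  then have "(a + 1) * (k - b / a) = b / a"
    using ka by simp
  then have "k - b / a > 0"
    using assms(1,2) by (metis add_pos_pos divide_pos_pos zero_less_mult_pos zero_less_one)
  then have 3: "\<mu> + b / a < 0"
    using k by simp
  \<comment> \<open>The slack of the column 3 inequality at \<open>\<mu> = - k\<close>; the factor
    \<open>a + 1\<close> allows \<open>k\<close> to be eliminated by \<open>ka\<close>.\<close>
  have "(a + 1) * (k * (1 - c) - ((a + 1) + (a + 1) / a + b / a))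
      = k * (a + 1) * (1 - c) - (a + 1) * ((a + 1) + (a + 1) / a + b / a)"
    by (simp add: algebra_simps)
  also have "\<dots> = (b + - c * b) * (1 + 2 / a) - (a + 1) * ((a + 1) + (a + 1) / a + b / a)"
    unfolding ka by (simp add: algebra_simps)
  also have "\<dots> = (b + 1) / a"
    unfolding assms(3) using assms(1) by (simp add: field_simps power2_eq_square)
  finally have "k * (1 - c) - ((a + 1) + (a + 1) / a + b / a) > 0"
    using assms(1,2) by (metis add_pos_pos divide_pos_pos zero_less_mult_pos zero_less_one)
  moreover have "k * (1 - c) < (- \<mu>) * (1 - c)"
    using k \<open>- c > 0\<close> by (intro mult_strict_right_mono) auto
  ultimately have 4: "\<mu> + b / a < - (a + 1) + \<mu> * c - (a + 1) / a"
    by (simp add: algebra_simps)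
  have "\<mu> * (a + 1) < - k * (a + 1)"
    using k assms(1) by (intro mult_strict_right_mono) auto
  also have "- k * (a + 1) = - b - 2 * (b / a)"
    using ka by simp
  finally have 5: "\<mu> + b / a < - b - \<mu> * a - b / a"
    by (simp add: algebra_simps)
  have 6: "\<mu> + b / a < 1 / a"
    using 3 assms(1) by (smt (verit) zero_less_divide_1_iff)
  show "entering_columns (cyc_tableau a b c \<mu>) = {1}"
    using \<mu> 1 2 by (simp add: entering_cyc_tableau_iff)
  show "entering_columns (gauss_jordan_pivot (cyc_tableau a b c \<mu>) 1 1) = {2}"
    using 3 4 5 6 by (simp add: entering_pivot_cyc_tableau_iff[OF assms(1,3)])
qed

lemma entering_columns_imp_bound:
  fixes a b c \<mu> :: real
  assumes "a > 0" "- c * b = 1 + a + a\<^sup>2"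
    and "entering_columns (gauss_jordan_pivot (cyc_tableau a b c \<mu>) 1 1) = {2}"
  shows "\<mu> < - (b * (a + 2) / (a * (a + 1)))"
proof -
  have "\<mu> + b / a < - b - \<mu> * a - b / a"
    using assms by (simp add: entering_pivot_cyc_tableau_iff[OF assms(1,2)])
  then have "\<mu> * (a + 1) < - b - 2 * (b / a)"
    by (simp add: algebra_simps)
  also have "- b - 2 * (b / a) = - (b * (a + 2) / (a * (a + 1))) * (a + 1)"
    using bound_times_Suc[OF assms(1), of b] by simp
  finally show ?thesis
    using assms(1) by (simp only: mult_less_cancel_right_pos add_pos_pos zero_less_one)
qed

lemma mu_bounds_imp_less:
  fixes a b \<mu> :: real
  assumes "a > 0" "-1 < \<mu>" "\<mu> < - (b * (a + 2) / (a * (a + 1)))"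
  shows "b < a * ((a + 1) / (a + 2))"
proof -
  have "b * (a + 2) / (a * (a + 1)) < 1"
    using assms by linarith
  then have "b * (a + 2) < a * (a + 1)"
    using assms(1) by simp
  then show ?thesis
    using assms(1) by (simp add: field_simps)
qed

text \<open>After undoing the shifts, the column rule concerns only the first two tableaux, and the
  row rule becomes a lower bound on \<open>row1_level\<close> for every pair of pivots.\<close>

lemma cycles_2_6_cyc_tableau_iff:
  fixes a b c' \<mu> \<tau> u :: real
  assumes T: "initial_tableau N c = cyc_tableau a b c' \<mu>"
    and a: "a > 0" and b: "b > 0" and c': "- c' * b = 1 + a + a\<^sup>2" and \<tau>: "\<tau> > 0" and u: "u \<ge> 0"
  shows "cycles_2_6 \<tau> u N c \<longleftrightarrow>
    a \<le> 1/2 \<and> -1 < \<mu> \<and> \<mu> < - (b * (a + 2) / (a * (a + 1)))"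
proof -
  let ?T = "cyc_tableau a b c' \<mu>"
  define w where "w = (\<lambda>m. if m < 2 then 0 else row1_level a (m - 2) - 1)"
  define S where "S m = cyc_state ?T (- of_nat (2 * m)) (\<tau> * row1_level a m)
    (\<tau> * (row2_level a m / b)) (\<tau> * w m) (\<tau> * w (Suc m))" for m
  define R where "R = pattern_run \<tau> (initial_state N c)"
  have R0: "initial_state N c = cyc_state ?T 0 0 0 0 0"
    by (simp add: initial_state_def cyc_state_def T vec_eq_iff forall_6 fun_eq_iff)
  define Q where "Q m \<longleftrightarrow> entering_columns (tableau (R m)) = {of_nat (Suc m)} \<and>
    leaving_row (\<tau> * (u + real (Suc m))) (R m) (of_nat (Suc m)) (if even m then 1 else 2)" for m
  have cycles: "cycles_2_6 \<tau> u N c \<longleftrightarrow> (\<forall>m. Q m) \<and> tableau (R 2) = (\<chi> i j. ?T $ i $ (j - 2))"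
    unfolding cycles_2_6_iff_pattern_run Q_def R_def T ..
  have c'neg: "c' < 0"
  proof -
    have "- c' * b > 0"
      unfolding c' using a by (intro add_pos_pos) auto
    then show ?thesis
      using b by (simp add: mult_less_0_iff)
  qed
  have tab: "tableau (S m) = ?T" "tableau (next_state \<tau> (S m) 1 1) = gauss_jordan_pivot ?T 1 1" for m
    by (simp_all add: S_def cyc_state_def next_state_def)
  have R_even: "R (2 * m) = shift_state (of_nat (2 * m)) (S m)"
    and R_odd: "R (Suc (2 * m)) = shift_state (of_nat (2 * m)) (next_state \<tau> (S m) 1 1)"
    if "a \<le> - c'" for m
  proof -
    show *: "R (2 * m) = shift_state (of_nat (2 * m)) (S m)"
      using pattern_run_cyc[OF a b c' that \<tau>, of \<mu> m] by (simp add: R_def R0 S_def w_def)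
    have "R (Suc (2 * m)) = next_state \<tau> (R (2 * m)) (1 + of_nat (2 * m)) 1"
      by (simp add: R_def)
    then show "R (Suc (2 * m)) = shift_state (of_nat (2 * m)) (next_state \<tau> (S m) 1 1)"
      unfolding * next_state_shift .
  qed
  have shift_eq: "(\<lambda>k. k + s) ` E = {k + s} \<longleftrightarrow> E = {k}" for E and k s :: 6
    using inj_image_eq_iff[of "\<lambda>k. k + s" E "{k}"] by (simp add: inj_def)
  have Q_even: "Q (2 * m) \<longleftrightarrow> entering_columns ?T = {1} \<and>
      leaving_row (\<tau> * (u + real (Suc (2 * m)))) (S m) 1 1" if "a \<le> - c'" for m
  proof -
    have "of_nat (Suc (2 * m)) = (1 :: 6) + of_nat (2 * m)"
      by simp
    then show ?thesis
      unfolding Q_def R_even[OF that]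
      by (simp only: entering_columns_shift leaving_row_shift tab shift_eq) simp
  qed
  have Q_odd: "Q (Suc (2 * m)) \<longleftrightarrow> entering_columns (gauss_jordan_pivot ?T 1 1) = {2} \<and>
      leaving_row (\<tau> * (u + real (Suc (Suc (2 * m))))) (next_state \<tau> (S m) 1 1) 2 2"
    if "a \<le> - c'" for m
  proof -
    have "of_nat (Suc (Suc (2 * m))) = (2 :: 6) + of_nat (2 * m)"
      by simp
    then show ?thesis
      unfolding Q_def R_odd[OF that]
      by (simp only: entering_columns_shift leaving_row_shift tab shift_eq) simp
  qed
  have level: "w m - b * (row2_level a m / b) - (1 + a) = row1_level a (Suc m)" for m
    using b by (simp add: w_def)
  \<comment> \<open>The closed form of the run needs \<open>a \<le> - c'\<close>; the bounds on
    \<open>\<mu>\<close> supply it through \<open>b < a\<close>.\<close>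
  have le: "a \<le> - c'" if "-1 < \<mu>" "\<mu> < - (b * (a + 2) / (a * (a + 1)))"
  proof -
    have "b < a * ((a + 1) / (a + 2))"
      using mu_bounds_imp_less[OF a that] .
    also have "\<dots> \<le> a * 1"
      using a by (intro mult_left_mono) auto
    finally have "a * b \<le> a * a"
      using a by simp
    also have "\<dots> \<le> - c' * b"
      unfolding c' using a by (simp add: power2_eq_square)
    finally show ?thesis
      using b by (simp only: mult_le_cancel_right_pos)
  qed
  show ?thesis
  proof
    assume "cycles_2_6 \<tau> u N c"
    then have Q: "Q m" for m
      using cycles by blast
    \<comment> \<open>Iterations 1 and 2 are unfolded directly, since \<open>a \<le> - c'\<close> is
      not yet available.\<close>
    have "entering_columns ?T = {1}" "entering_columns (gauss_jordan_pivot ?T 1 1) = {2}"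
      using Q[of 0] Q[of 1] by (simp_all add: Q_def R_def R0 cyc_state_def next_state_def)
    then have \<mu>: "-1 < \<mu>" "\<mu> < - (b * (a + 2) / (a * (a + 1)))"
      using entering_columns_imp_bound[OF a c'] by (simp_all add: entering_cyc_tableau_iff)
    have "0 \<le> row1_level a (Suc m) + (u + real (Suc (Suc (2 * m))))" for m
      using Q[of "Suc (2 * m)"] leaving_row_cyc_2(1)[OF a b c' \<tau> row1_level_nonpos[of a m]] a
      unfolding Q_odd[OF le[OF \<mu>]] S_def by (metis level less_imp_le)
    then have "0 \<le> row1_level a m + (u + 2 * real m)" for m
      using u by (cases m) (auto simp: algebra_simps simp del: row1_level.simps(2))
    then have "\<not> a > 1/2"
      by (metis row1_level_unbounded add.commute less_minus_iff neg_less_iff_less not_less real_add_less_0_iff)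
    then show "a \<le> 1/2 \<and> -1 < \<mu> \<and> \<mu> < - (b * (a + 2) / (a * (a + 1)))"
      using \<mu> by simp
  next
    assume *: "a \<le> 1/2 \<and> -1 < \<mu> \<and> \<mu> < - (b * (a + 2) / (a * (a + 1)))"
    then have c'le: "a \<le> - c'"
      using le by blast
    have "b < a * ((a + 1) / (a + 2))"
      using mu_bounds_imp_less[OF a] * by blast
    also have "\<dots> \<le> 1 * 1"
      using a * by (intro mult_mono) auto
    finally have b1: "b < 1"
      by simp
    have ent: "entering_columns ?T = {1}" "entering_columns (gauss_jordan_pivot ?T 1 1) = {2}"
      using entering_columns_bounds[OF a b c'] * by blast+
    have "Q (2 * m)" for m
      unfolding Q_even[OF c'le] S_def using ent a c'neg u \<tau>
      by (auto intro!: leaving_row_cyc_1)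
    moreover have "Q (Suc (2 * m))" for m
    proof -
      have "0 \<le> row1_level a (Suc m) + (u + real (Suc (Suc (2 * m))))"
        using row1_level_lower_bound[of a "Suc m"] a * u by (simp del: row1_level.simps)
      then have "leaving_row (\<tau> * (u + real (Suc (Suc (2 * m))))) (next_state \<tau> (S m) 1 1) 2 2"
        unfolding S_def level[symmetric]
        by (rule leaving_row_cyc_2(2)[OF a b c' \<tau> row1_level_nonpos[OF less_imp_le[OF a]]]) (use a u b1 in simp_all)
      then show ?thesis
        unfolding Q_odd[OF c'le] using ent by blast
    qed
    ultimately have "Q m" for m
      by (cases "even m") (auto elim!: evenE oddE)
    moreover have "tableau (R 2) = (\<chi> i j. ?T $ i $ (j - 2))"
      using R_even[OF c'le, of 1] by (simp add: vec_eq_iff tab)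
    ultimately show "cycles_2_6 \<tau> u N c"
      using cycles by blast
  qed
qed

section \<open>The equivalence for arbitrary initial tableaux\<close>

theorem proposition5:
  fixes N :: "real^4^2" and c :: "real^4" and A :: "real^2^2" and M1 :: "real^6^3"
    and \<mu> \<tau> u :: real
  assumes M1: "M1 = initial_tableau N c"
    and A: "A$1$1 = M1$1$1" "A$1$2 = M1$1$2" "A$2$1 = M1$2$1" "A$2$2 = M1$2$2"
    and normalized: "M1$3$1 = -1" "M1$3$2 = \<mu>"
    and signs: "A$2$1 < 0" "0 < A$1$2"
    and expand_parameters: "\<tau> > 0" "u \<ge> 0"
  shows "(cycles_2_6 \<tau> u N c \<longleftrightarrow>
      (M1 = vector
         [vector [A$1$1, A$1$2, - (A$1$1 + 1), - (A$1$2), 1, 0],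
          vector [A$2$1, - (A$1$1 + 1), - (A$2$1), A$1$1, 0, 1],
          vector [-1, \<mu>, - (A$1$1 + 1) + \<mu> * A$2$1, - (A$1$2) - \<mu> * A$1$1, 0, 0]]
       \<and> - (A$2$1) * A$1$2 = 1 + A$1$1 + (A$1$1)\<^sup>2)
      \<and> (0 < A$1$1 \<and> A$1$1 \<le> 1/2 \<and> 0 < A$1$2)
      \<and> (-1 < \<mu> \<and> \<mu> < - (A$1$2 * (A$1$1 + 2) / (A$1$1 * (A$1$1 + 1)))))
    \<and> (0 < A$1$1 \<and> A$1$1 \<le> 1/2 \<and> 0 < A$1$2
       \<and> -1 < \<mu> \<and> \<mu> < - (A$1$2 * (A$1$1 + 2) / (A$1$1 * (A$1$1 + 1)))
       \<longrightarrow> A$1$2 < A$1$1 * ((A$1$1 + 1) / (A$1$1 + 2)))"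
proof -
  let ?T = "cyc_tableau (A$1$1) (A$1$2) (A$2$1) \<mu>"
  have form: "0 < A$1$1" "M1 = ?T" "- (A$2$1) * A$1$2 = 1 + A$1$1 + (A$1$1)\<^sup>2"
    if "cycles_2_6 \<tau> u N c"
  proof -
    let ?R = "pattern_run \<tau> (initial_state N c)"
    have leave: "leaving_row (\<tau> * (u + real (Suc m))) (?R m) (of_nat (Suc m)) (if even m then 1 else 2)" for m
      using that unfolding cycles_2_6_iff_pattern_run by blast
    have shift: "tableau (?R 2) = (\<chi> i j. M1 $ i $ (j - 2))"
      using that unfolding cycles_2_6_iff_pattern_run M1 by blast
    have R: "tableau (?R 0) = M1" "tableau (?R 1) = gauss_jordan_pivot M1 1 1"
        "tableau (?R 2) = gauss_jordan_pivot (gauss_jordan_pivot M1 1 1) 2 2"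
      by (simp_all add: M1 initial_state_def next_state_def numeral_2_eq_2)
    \<comment> \<open>The leaving rows of iterations 1 and 2 are eligible, so their pivot elements
      are positive.\<close>
    have pos: "M1$1$1 > 0" "gauss_jordan_pivot M1 1 1 $ 2 $ 2 > 0"
      using leave[of 0] leave[of 1] unfolding leaving_row_def mem_eligible_rows_iff R(1,2)
      by simp_all
    then show "0 < A$1$1"
      by (simp add: A)
    have "M1$2$1 \<noteq> 0"
      using signs A by simp
    then show "M1 = ?T" "- (A$2$1) * A$1$2 = 1 + A$1$1 + (A$1$1)\<^sup>2"
      using initial_tableau_eq_cyc_tableau[of N c, folded M1] pos normalized shift
      unfolding R A by auto
  qed
  have "cycles_2_6 \<tau> u N c \<longleftrightarrow> (M1 = ?T \<and> - (A$2$1) * A$1$2 = 1 + A$1$1 + (A$1$1)\<^sup>2)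
      \<and> (0 < A$1$1 \<and> A$1$1 \<le> 1/2 \<and> 0 < A$1$2)
      \<and> (-1 < \<mu> \<and> \<mu> < - (A$1$2 * (A$1$1 + 2) / (A$1$1 * (A$1$1 + 1))))"
  proof (cases "0 < A$1$1 \<and> M1 = ?T \<and> - (A$2$1) * A$1$2 = 1 + A$1$1 + (A$1$1)\<^sup>2")
    case True
    then have "initial_tableau N c = ?T"
      using M1 by simp
    from cycles_2_6_cyc_tableau_iff[OF this _ signs(2) _ expand_parameters] True signs(2)
    show ?thesis by blast
  next
    case False
    then show ?thesis using form by blast
  qed
  then show ?thesis
    unfolding cyc_tableau_def using mu_bounds_imp_less by blast
qed

end
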